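(* Let $r,n$ be positive integers with $r\equiv2\pmod4$, let $\pi\in A_{r,n}$, and for each $2\le i\le n$ let $\delta_i=\delta_i(\pi)=1$ if $z_i(\pi)\in\{0,\frac r2\}$ and $\delta_i=0$ otherwise. Then $$F(\pi):=\sum_{\sigma\in p^{-1}(p(\pi))}q^{\ell_F(\sigma)}=\prod_{i=2}^n\Bigl(1+q^{2\delta_i(i-1-l_i)}\Bigr),$$ where $l_i=|\{j: j<i,\ |\pi|^{-1}(i)<|\pi|^{-1}(j)\}|$ for $1\le i\le n$.
   Context: For positive integers $m,n$, $G_{m,n}=\mathbb{Z}_m\wr S_n$ is the set of pairs $(\vec z,\tau)$ with $\vec z=(z_1,\dots,z_n)\in\{0,\dots,m-1\}^n$, $\tau\in S_n$, with product $(\vec z,\tau)(\vec z',\tau')=((z_1+z'_{\tau^{-1}(1)},\dots,z_n+z'_{\tau^{-1}(n)}),\tau\circ\tau')$, addition mod $m$. For $\pi=(\vec z,\tau)$: $z_i(\pi)=z_i$ is the color of the digit $i$; $|\pi|=(\vec0,\tau)$ is identified with $\tau$; $c_i(\pi)=z_{\tau(i)}$ is the color of the digit in place $i$; the window notation is $\pi=(\tau(1)^{[c_1]}\cdots\tau(n)^{[c_n]})$. The generator $s_0$ is the pair with vector $(1,0,\dots,0)$ and identity permutation; for $1\le i\le n-1$, $s_i$ is the pair with zero vector and transposition $(i\ i+1)$. $A_{r,n}$ is the kernel of the homomorphism $G_{r,n}\to\{\pm1\}$ sending every $s_i$, $0\le i\le n-1$, to $-1$. Put $a_0=s_0^2$,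 $a_i=s_0^{r/2}s_i$ for $1\le i\le n-1$, and $\mathcal A=\{a_0,a_1,a_1^{-1},a_2,\dots,a_{n-1}\}$, a generating set of $A_{r,n}$; $\ell_{\mathcal A}(\pi)$ is the minimal $u$ such that $\pi$ is a product of $u$ elements of $\mathcal A$. For a nonnegative integer $a$, $a\oslash 2\in\{0,\dots,\frac r2-1\}$ is the residue modulo $\frac r2$ of $\frac a2$ if $a$ is even, and of $\frac{a+r/2}{2}$ if $a$ is odd. The covering map $p:A_{r,n}\to G_{\frac r2,n}$ is $p((b_1^{[c_1]}\cdots b_n^{[c_n]}))=(b_1^{[c_1\oslash2]}\cdots b_n^{[c_n\oslash2]})$. Its section $s:G_{\frac r2,n}\to A_{r,n}$ is defined as follows: for $\pi=(p_1^{[c_1]}\cdots p_n^{[c_n]})$ with $p_j=1$, $s(\pi)=(p_1^{[2c_1]}\cdots p_n^{[2c_n]})$ if the usual inversion number $\mathrm{inv}(|\pi|)$ is even, and if $\mathrm{inv}(|\pi|)$ is odd, $s(\pi)$ is the same except that the color of $p_j=1$ is $2c_j+\frac r2$ (colors computed mod $r$). For $\pi\in A_{r,n}$ the fibral length is $\ell_F(\pi)=\ell_{\mathcal A}(\pi)-\ell_{\mathcal A}(s(p(\pi)))$. *)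

theory Defs
  imports
    "HOL-Algebra.Coset"
    "HOL-Combinatorics.Permutations"
    "HOL-Computational_Algebra.Formal_Laurent_Series"
begin

text \<open>A coloured permutation is a pair \<open>(z, \<tau>)\<close>: \<open>z i\<close> is the colour of the digit \<open>i\<close>, and \<open>\<tau>\<close> is the
  underlying permutation, with \<open>\<tau> i\<close> the digit in place \<open>i\<close>. Digits and places are \<open>1, \<dots>, n\<close>; colour
  vectors are extended by \<open>0\<close> and permutations by the identity outside \<open>{1..n}\<close>, so that equality of
  pairs is equality of coloured permutations.\<close>

type_synonym cperm = "(nat \<Rightarrow> nat) \<times> (nat \<Rightarrow> nat)"

text \<open>In the presence of the group-inverse syntax of HOL-Algebra we name the inverse permutation.\<close>

definition perm_inv :: "(nat \<Rightarrow> nat) \<Rightarrow> nat \<Rightarrow> nat"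
  where "perm_inv \<tau> = inv_into UNIV \<tau>"

definition G :: "nat \<Rightarrow> nat \<Rightarrow> cperm monoid"
  where "G m n = \<lparr>
    carrier = {(z, \<tau>). (\<forall>i\<in>{1..n}. z i < m) \<and> (\<forall>i. i \<notin> {1..n} \<longrightarrow> z i = 0) \<and> \<tau> permutes {1..n}},
    monoid.mult = (\<lambda>(z, \<tau>) (z', \<tau>'). (\<lambda>i. (z i + z' (perm_inv \<tau> i)) mod m, \<tau> \<circ> \<tau>')),
    one = (\<lambda>_. 0, id)\<rparr>"

definition s_gen :: "nat \<Rightarrow> nat \<Rightarrow> cperm"
  where "s_gen m i = (if i = 0 then (\<lambda>j. if j = 1 then 1 mod m else 0, id)
                      else (\<lambda>_. 0, transpose i (Suc i)))"

definition sign_group :: "int monoid"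
  where "sign_group = \<lparr>carrier = {1, -1}, monoid.mult = (*), one = 1\<rparr>"

text \<open>For even \<open>r\<close> the homomorphism below exists (lemma \<open>alt_hom_exists\<close>), and since the \<open>s_gen r i\<close>
  generate \<open>G r n\<close> it is determined on the carrier; its values off the carrier do not matter.\<close>

definition alt_hom :: "nat \<Rightarrow> nat \<Rightarrow> cperm \<Rightarrow> int"
  where "alt_hom r n = (SOME \<chi>. \<chi> \<in> hom (G r n) sign_group \<and> (\<forall>i<n. \<chi> (s_gen r i) = -1))"

definition A :: "nat \<Rightarrow> nat \<Rightarrow> cperm set"
  where "A r n = kernel (G r n) sign_group (alt_hom r n)"

definition a_gen :: "nat \<Rightarrow> nat \<Rightarrow> nat \<Rightarrow> cperm"
  where "a_gen r n i =
    (if i = 0 then s_gen r 0 [^]\<^bsub>G r n\<^esub> (2::nat)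
     else s_gen r 0 [^]\<^bsub>G r n\<^esub> (r div 2) \<otimes>\<^bsub>G r n\<^esub> s_gen r i)"

text \<open>For \<open>n = 1\<close> there is no \<open>a\<^sub>1\<close>, hence no \<open>a\<^sub>1\<inverse>\<close>.\<close>

definition A_gens :: "nat \<Rightarrow> nat \<Rightarrow> cperm set"
  where "A_gens r n = a_gen r n ` {..<n} \<union> {inv\<^bsub>G r n\<^esub> (a_gen r n i) | i. i = 1 \<and> i < n}"

definition len_A :: "nat \<Rightarrow> nat \<Rightarrow> cperm \<Rightarrow> nat"
  where "len_A r n \<pi> = (LEAST u. \<exists>ws. length ws = u \<and> set ws \<subseteq> A_gens r n \<and>
                          foldr (monoid.mult (G r n)) ws \<one>\<^bsub>G r n\<^esub> = \<pi>)"

definition half_res :: "nat \<Rightarrow> nat \<Rightarrow> nat"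
  where "half_res r a = (if even a then a div 2 else (a + r div 2) div 2) mod (r div 2)"

text \<open>The covering map keeps the window and changes the colour of every digit; since colour vectors
  are indexed by digits, this acts on \<open>z\<close> pointwise (and \<open>half_res r 0 = 0\<close> outside \<open>{1..n}\<close>).\<close>

definition cover :: "nat \<Rightarrow> cperm \<Rightarrow> cperm"
  where "cover r = (\<lambda>(z, \<tau>). (\<lambda>i. half_res r (z i), \<tau>))"

definition inv_number :: "nat \<Rightarrow> (nat \<Rightarrow> nat) \<Rightarrow> nat"
  where "inv_number n \<tau> = card {(i, j). 1 \<le> i \<and> i < j \<and> j \<le> n \<and> \<tau> j < \<tau> i}"

definition cover_section :: "nat \<Rightarrow> nat \<Rightarrow> cperm \<Rightarrow> cperm"
  where "cover_section r n = (\<lambda>(z, \<tau>).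
    (\<lambda>i. (2 * z i + (if i = 1 \<and> odd (inv_number n \<tau>) then r div 2 else 0)) mod r, \<tau>))"

definition fibral_len :: "nat \<Rightarrow> nat \<Rightarrow> cperm \<Rightarrow> int"
  where "fibral_len r n \<pi> = int (len_A r n \<pi>) - int (len_A r n (cover_section r n (cover r \<pi>)))"

definition delta :: "nat \<Rightarrow> cperm \<Rightarrow> nat \<Rightarrow> int"
  where "delta r \<pi> i = (if fst \<pi> i \<in> {0, r div 2} then 1 else 0)"

definition l_stat :: "cperm \<Rightarrow> nat \<Rightarrow> nat"
  where "l_stat \<pi> i = card {j. 1 \<le> j \<and> j < i \<and> perm_inv (snd \<pi>) i < perm_inv (snd \<pi>) j}"

text \<open>\<open>fibral_len\<close> is a difference of lengths, so the generating function is a Laurent polynomial in the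
  formal variable \<open>q\<close>; \<open>fls_X_intpow k\<close> is \<open>q\<^sup>k\<close> for an integer \<open>k\<close>.\<close>

definition fiber_gf :: "nat \<Rightarrow> nat \<Rightarrow> cperm \<Rightarrow> int fls"
  where "fiber_gf r n \<pi> =
    (\<Sum>\<sigma> | \<sigma> \<in> A r n \<and> cover r \<sigma> = cover r \<pi>. fls_X_intpow (fibral_len r n \<sigma>))"


lemma group_G:
  assumes "m > 0"
  shows "group (G m n)"
proof (rule groupI)
  show "\<one>\<^bsub>G m n\<^esub> \<in> carrier (G m n)"
    using assms by (auto simp: G_def permutes_id)
next
  fix x y assume xy: "x \<in> carrier (G m n)" "y \<in> carrier (G m n)"
  obtain z \<tau> z' \<tau>' where [simp]: "x = (z, \<tau>)" "y = (z', \<tau>')" by (cases x, cases y)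
  have "perm_inv \<tau> permutes {1..n}"
    using xy by (simp add: G_def perm_inv_def permutes_inv)
  then have "perm_inv \<tau> i = i" if "i \<notin> {1..n}" for i
    using that by (meson permutes_not_in)
  then show "x \<otimes>\<^bsub>G m n\<^esub> y \<in> carrier (G m n)"
    using xy assms by (auto simp: G_def intro: permutes_compose)
next
  fix x y w assume "x \<in> carrier (G m n)" "y \<in> carrier (G m n)" "w \<in> carrier (G m n)"
  then show "x \<otimes>\<^bsub>G m n\<^esub> y \<otimes>\<^bsub>G m n\<^esub> w = x \<otimes>\<^bsub>G m n\<^esub> (y \<otimes>\<^bsub>G m n\<^esub> w)"
    by (auto simp: G_def perm_inv_def o_inv_distrib permutes_bij fun_eq_iff mod_simps add.assoc)
next
  fix x assume "x \<in> carrier (G m n)"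
  moreover from this have "fst x i mod m = fst x i" for i
    by (cases "i \<in> {1..n}") (auto simp: G_def)
  ultimately show "\<one>\<^bsub>G m n\<^esub> \<otimes>\<^bsub>G m n\<^esub> x = x"
    by (auto simp: G_def perm_inv_def)
next
  fix x assume x: "x \<in> carrier (G m n)"
  obtain z \<tau> where [simp]: "x = (z, \<tau>)" by (cases x)
  have \<tau>: "\<tau> permutes {1..n}" using x by (simp add: G_def)
  define y :: cperm where "y = (\<lambda>i. (m - z (\<tau> i)) mod m, perm_inv \<tau>)"
  have pinv: "perm_inv \<tau> permutes {1..n}" "perm_inv (perm_inv \<tau>) = \<tau>"
    using \<tau> by (simp_all add: perm_inv_def permutes_inv permutes_inv_inv)
  have "y \<in> carrier (G m n)"
    using x pinv assms permutes_not_in[OF \<tau>] by (auto simp: G_def y_def)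
  moreover have "z i \<le> m" for i
    using x by (cases "i \<in> {1..n}") (auto simp: G_def less_imp_le)
  then have "y \<otimes>\<^bsub>G m n\<^esub> x = \<one>\<^bsub>G m n\<^esub>"
    using pinv \<tau> by (auto simp: G_def y_def mod_simps perm_inv_def permutes_inv_o)
  ultimately show "\<exists>y\<in>carrier (G m n). y \<otimes>\<^bsub>G m n\<^esub> x = \<one>\<^bsub>G m n\<^esub>" by blast
qed

lemma alt_hom_exists:
  assumes "even r" "r > 0"
  shows "\<exists>\<chi>. \<chi> \<in> hom (G r n) sign_group \<and> (\<forall>i<n. \<chi> (s_gen r i) = -1)"
proof (intro exI conjI allI impI)
  let ?\<chi> = "\<lambda>(z, \<tau>). (-1) ^ (\<Sum>i=1..n. z i) * sign \<tau> :: int"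
  have neg1_mod: "(-1::int) ^ (k mod r) = (-1) ^ k" for k
    using assms by (simp add: minus_one_power_iff dvd_mod_iff)
  show "?\<chi> \<in> hom (G r n) sign_group"
  proof (rule homI)
    fix x :: cperm
    show "?\<chi> x \<in> carrier sign_group"
      by (cases x) (simp add: sign_group_def sign_def minus_one_power_iff)
  next
    fix x y assume xy: "x \<in> carrier (G r n)" "y \<in> carrier (G r n)"
    obtain z \<tau> z' \<tau>' where [simp]: "x = (z, \<tau>)" "y = (z', \<tau>')" by (cases x, cases y)
    have \<tau>: "\<tau> permutes {1..n}" "\<tau>' permutes {1..n}" using xy by (simp_all add: G_def)
    have "(-1::int) ^ (\<Sum>i=1..n. (z i + z' (perm_inv \<tau> i)) mod r)
        = (-1) ^ (\<Sum>i=1..n. z i + z' (perm_inv \<tau> i))"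
      by (simp add: power_sum neg1_mod)
    also have "\<dots> = (-1) ^ (\<Sum>i=1..n. z i) * (-1) ^ (\<Sum>i=1..n. z' (perm_inv \<tau> i))"
      by (simp add: sum.distrib power_add)
    also have "(\<Sum>i=1..n. z' (perm_inv \<tau> i)) = (\<Sum>i=1..n. z' i)"
      using sum.permute[OF permutes_inv[OF \<tau>(1)], of z'] by (simp add: perm_inv_def o_def)
    finally show "?\<chi> (x \<otimes>\<^bsub>G r n\<^esub> y) = ?\<chi> x \<otimes>\<^bsub>sign_group\<^esub> ?\<chi> y"
      using permutes_imp_permutation[OF _ \<tau>(1)] permutes_imp_permutation[OF _ \<tau>(2)]
      by (simp add: G_def sign_group_def sign_compose)
  qed
next
  fix i assume "i < n"
  moreover have "1 mod r = 1" using assms by (cases "r = 1") auto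
  moreover have "(\<Sum>j=1..n. if j = 1 then 1 else 0 :: nat) = 1" if "0 < n"
    using that by simp
  ultimately show "(\<lambda>(z, \<tau>). (-1) ^ (\<Sum>i=1..n. z i) * sign \<tau> :: int) (s_gen r i) = -1"
    by (cases "i = 0") (simp_all add: s_gen_def sign_swap_id sign_id)
qed

end

theory Submission
  imports Defs
begin

text \<open>Multiplying on the left by \<open>s\<^sub>0\<close> or \<open>s\<^sub>i\<close> recolours the digit \<open>1\<close> or swaps the digits \<open>i\<close> and \<open>i + 1\<close>.
  The length is therefore computed digit by digit: a digit \<open>i\<close> of colour \<open>0\<close> costs \<open>l\<^sub>i\<close>, while a digit of
  nonzero colour has to travel to the value \<open>1\<close>, get its colour, and travel back, which costs
  \<open>2 (i - 1) - l\<^sub>i\<close> plus the halved colour. Recolouring by \<open>r / 2\<close> leaves this weight unchanged, every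
  generator raises it by at most one, and every nontrivial element admits a generator lowering it, so
  it is the length. In a fibre the colour of each digit \<open>i \<ge> 2\<close> varies freely between \<open>x\<close> and
  \<open>x + r / 2\<close>, the colour of \<open>1\<close> being forced by parity; the odd choice costs nothing unless
  \<open>x \<in> {0, r / 2}\<close>, when it costs \<open>2 (i - 1 - l\<^sub>i)\<close>.\<close>

section \<open>Halving colours modulo \<open>r div 2\<close>\<close>

lemma half_res_0 [simp]: "half_res r 0 = 0"
  by (simp add: half_res_def)


lemma half_res_mod:
  assumes "even r"
  shows "half_res r (c mod r) = half_res r c"
proof -
  obtain k where k: "r = 2 * k" using assms by blast
  define m where "m = c mod r"
  define p where "p = k * (c div r)"
  have "c = 2 * p + m"
    using div_mult_mod_eq[of c r] by (simp add: p_def m_def k mult_ac)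
  then have "even c \<longleftrightarrow> even m" "c div 2 = p + m div 2" "(c + k) div 2 = p + (m + k) div 2"
    by presburger+
  moreover have "(p + x) mod k = x mod k" for x by (simp add: p_def)
  ultimately show ?thesis
    unfolding half_res_def m_def[symmetric] by (simp add: k)
qed

lemma half_res_less: "r \<ge> 2 \<Longrightarrow> half_res r c < r div 2"
  by (simp add: half_res_def)

text \<open>Adding the odd number \<open>r div 2\<close> flips the parity and so switches the branch
  of the definition: for odd \<open>c\<close> the very same number gets halved, for even
  \<open>c\<close> a full \<open>r\<close> is added before halving.\<close>

lemma half_res_add_half:
  assumes "r mod 4 = 2"
  shows "half_res r (c + r div 2) = half_res r c"
proof -
  define k where "k = r div 2"
  have k: "odd k" "r = 2 * k" using assms unfolding k_def by presburger+
  show ?thesis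
  proof (cases "even c")
    case True
    then have "(c + k + k) div 2 = c div 2 + k" by presburger
    then show ?thesis using True k by (simp add: half_res_def)
  next
    case False
    then show ?thesis using k by (simp add: half_res_def)
  qed
qed

lemma half_res_add_2:
  assumes "r mod 4 = 2"
  shows "half_res r (c + 2) = (half_res r c + 1) mod (r div 2)"
proof -
  have "(c + 2 + r div 2) div 2 = (c + r div 2) div 2 + 1" by presburger
  then show ?thesis by (simp add: half_res_def mod_simps)
qed

lemma half_res_double:
  assumes "r mod 4 = 2" "h < r div 2"
  shows "half_res r ((2 * h + (if b then r div 2 else 0)) mod r) = h"
proof -
  have "half_res r (2 * h) = h" using assms(2) by (simp add: half_res_def)
  moreover have "even r" using assms(1) by presburger
  ultimately show ?thesis using half_res_add_half[OF assms(1), of "2 * h"] by (simp add: half_res_mod)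
qed

text \<open>Chinese remainder theorem: \<open>r div 2\<close> being odd, a colour modulo
  \<open>r\<close> amounts to its halved colour together with its parity.\<close>

lemma double_half_res:
  assumes "r mod 4 = 2" "c < r"
  shows "(2 * half_res r c + (if odd c then r div 2 else 0)) mod r = c"
proof -
  define k where "k = r div 2"
  have k: "odd k" "r = 2 * k" using assms unfolding k_def by presburger+
  have dbl: "2 * (x mod k) = (2 * x) mod r" for x by (simp add: k)
  show ?thesis
  proof (cases "even c")
    case True
    then show ?thesis using assms(2) by (simp add: half_res_def dbl k_def[symmetric])
  next
    case False
    then have "2 * ((c + k) div 2) = c + k" using k by simp
    then have "2 * half_res r c = (c + k) mod r" using False by (simp add: half_res_def dbl k_def[symmetric])
    then have "(2 * half_res r c + k) mod r = (c + k + k) mod r" by (simp add: mod_add_left_eq)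
    also have "c + k + k = c + r" using k by simp
    finally have "(2 * half_res r c + k) mod r = (c + r) mod r" .
    then show ?thesis using False assms(2) by (simp add: k_def[symmetric])
  qed
qed

section \<open>The statistic \<open>l_stat\<close> and inversions\<close>

lemma l_stat_le: "l_stat g i \<le> i - 1"
proof -
  have "card {j. 1 \<le> j \<and> j < i \<and> perm_inv (snd g) i < perm_inv (snd g) j} \<le> card {1..<i}"
    by (rule card_mono) auto
  then show ?thesis by (simp add: l_stat_def)
qed

lemma l_stat_one [simp]: "l_stat g (Suc 0) = 0"
  using l_stat_le[of g "Suc 0"] by simp

text \<open>\<open>l_stat\<close> sorts the inversions by their larger digit;
  \<open>perm_inv \<tau>\<close> turns pairs of digits into the pairs of places counted by
  \<open>inv_number\<close>.\<close>

lemma sum_l_stat_eq_inv_number: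
  assumes "\<tau> permutes {1..n}"
  shows "(\<Sum>i=1..n. l_stat (z, \<tau>) i) = inv_number n \<tau>"
proof -
  define P where "P = perm_inv \<tau>"
  have P: "P permutes {1..n}" and PT: "P (\<tau> i) = i" "\<tau> (P i) = i" for i
    using assms by (auto simp: P_def perm_inv_def permutes_inv permutes_inverses)
  have inP: "P i \<in> {1..n} \<longleftrightarrow> i \<in> {1..n}" and inT: "\<tau> i \<in> {1..n} \<longleftrightarrow> i \<in> {1..n}" for i
    using permutes_in_image[OF P] permutes_in_image[OF assms] by auto
  have "(\<Sum>i=1..n. l_stat (z, \<tau>) i) = card (SIGMA i:{1..n}. {j. 1 \<le> j \<and> j < i \<and> P i < P j})"
    by (subst card_SigmaI) (auto simp: l_stat_def P_def)
  also have "\<dots> = card {(i, j). 1 \<le> i \<and> i < j \<and> j \<le> n \<and> \<tau> j < \<tau> i}"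
  proof (rule bij_betw_same_card[where f = "\<lambda>(i, j). (P i, P j)"],
      rule bij_betw_byWitness[where f' = "\<lambda>(i, j). (\<tau> i, \<tau> j)"])
    show "(\<lambda>(i, j). (P i, P j)) ` (SIGMA i:{1..n}. {j. 1 \<le> j \<and> j < i \<and> P i < P j})
      \<subseteq> {(i, j). 1 \<le> i \<and> i < j \<and> j \<le> n \<and> \<tau> j < \<tau> i}"
    proof clarify
      fix i j assume "i \<in> {1..n}" "1 \<le> j" "j < i" "P i < P j"
      then show "1 \<le> P i \<and> P i < P j \<and> P j \<le> n \<and> \<tau> (P j) < \<tau> (P i)"
        using inP[of i] inP[of j] by (simp add: PT)
    qed
    show "(\<lambda>(i, j). (\<tau> i, \<tau> j)) ` {(i, j). 1 \<le> i \<and> i < j \<and> j \<le> n \<and> \<tau> j < \<tau> i}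
      \<subseteq> (SIGMA i:{1..n}. {j. 1 \<le> j \<and> j < i \<and> P i < P j})"
    proof clarify
      fix i j assume "1 \<le> i" "i < j" "j \<le> n" "\<tau> j < \<tau> i"
      then show "\<tau> i \<in> {1..n} \<and> \<tau> j \<in> {j'. 1 \<le> j' \<and> j' < \<tau> i \<and> P (\<tau> i) < P j'}"
        using inT[of i] inT[of j] by (simp add: PT)
    qed
  qed (auto simp: PT)
  finally show ?thesis by (simp add: inv_number_def)
qed

section \<open>Elementary moves, weight and parity\<close>

text \<open>Left multiplication by \<open>s_gen r i\<close> for \<open>i \<ge> 1\<close>; colours
  are indexed by digits and hence permuted too.\<close>

definition swap_digits :: "nat \<Rightarrow> cperm \<Rightarrow> cperm"
  where "swap_digits i g = (fst g \<circ> transpose i (Suc i), transpose i (Suc i) \<circ> snd g)"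

definition recolor_one :: "nat \<Rightarrow> nat \<Rightarrow> cperm \<Rightarrow> cperm"
  where "recolor_one r t g = ((fst g)(1 := (fst g 1 + t) mod r), snd g)"

text \<open>For the digit \<open>1\<close> both cases agree on the colours \<open>0\<close> and \<open>r / 2\<close>.\<close>

definition digit_weight :: "nat \<Rightarrow> cperm \<Rightarrow> nat \<Rightarrow> int"
  where "digit_weight r g i = (if fst g i = 0 then int (l_stat g i)
    else 2 * (int i - 1) - int (l_stat g i) + int (half_res r (fst g i)))"

definition weight :: "nat \<Rightarrow> nat \<Rightarrow> cperm \<Rightarrow> int"
  where "weight r n g = (\<Sum>i=1..n. digit_weight r g i)"

text \<open>By \<open>sum_l_stat_eq_inv_number\<close> the second sum is the inversion number.\<close>

definition parity_sum :: "nat \<Rightarrow> cperm \<Rightarrow> nat"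
  where "parity_sum n g = (\<Sum>i=1..n. fst g i) + (\<Sum>i=1..n. l_stat g i)"

lemma weight_nonneg: "weight r n g \<ge> 0"
  unfolding weight_def
proof (rule sum_nonneg)
  fix i assume "i \<in> {1..n}"
  then show "0 \<le> digit_weight r g i"
    using l_stat_le[of g i] by (auto simp: digit_weight_def)
qed

lemma perm_inv_swap:
  assumes "bij \<tau>"
  shows "perm_inv (transpose i (Suc i) \<circ> \<tau>) = perm_inv \<tau> \<circ> transpose i (Suc i)"
  using assms by (simp add: perm_inv_def o_inv_distrib)

text \<open>The digits \<open>i\<close> and \<open>Suc i\<close> are both below \<open>j\<close> or
  both not below it, so the transposition maps one counted set onto the other.\<close>

lemma l_stat_swap_digits_other:
  assumes "bij (snd g)" "i \<ge> 1" "j \<noteq> i" "j \<noteq> Suc i"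
  shows "l_stat (swap_digits i g) j = l_stat g j"
proof -
  define P where "P = perm_inv (snd g)"
  let ?t = "transpose i (Suc i)"
  have tj: "?t j = j" using assms by simp
  have eq: "?t ` {m. 1 \<le> m \<and> m < j \<and> P j < P m} = {m. 1 \<le> m \<and> m < j \<and> P j < P (?t m)}"
  proof (rule Set.set_eqI)
    fix m
    have img: "m \<in> ?t ` X \<longleftrightarrow> ?t m \<in> X" for X
      by (metis image_iff transpose_involutory)
    have "1 \<le> ?t m \<and> ?t m < j \<longleftrightarrow> 1 \<le> m \<and> m < j"
      using assms(2-4) by (cases "m = i"; cases "m = Suc i") (simp_all, linarith+)
    then have "?t m \<in> {m. 1 \<le> m \<and> m < j \<and> P j < P m} \<longleftrightarrow>
        m \<in> {m. 1 \<le> m \<and> m < j \<and> P j < P (?t m)}"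
      by blast
    then show "m \<in> ?t ` {m. 1 \<le> m \<and> m < j \<and> P j < P m} \<longleftrightarrow>
        m \<in> {m. 1 \<le> m \<and> m < j \<and> P j < P (?t m)}"
      unfolding img .
  qed
  have "card {m. 1 \<le> m \<and> m < j \<and> P j < P (?t m)} = card {m. 1 \<le> m \<and> m < j \<and> P j < P m}"
    unfolding eq[symmetric] by (rule card_image) (rule inj_on_transpose)
  then show ?thesis
    using assms(1) tj by (simp add: l_stat_def swap_digits_def perm_inv_swap P_def)
qed

text \<open>\<open>Suc i\<close> takes over the place of \<open>i\<close>. The only new candidate
  among the smaller digits is \<open>i\<close>, now at the old place of
  \<open>Suc i\<close>.\<close>

lemma l_stat_swap_digits_Suc:
  assumes "bij (snd g)" "i \<ge> 1"
  shows "l_stat (swap_digits i g) (Suc i) =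
    l_stat g i + (if perm_inv (snd g) i < perm_inv (snd g) (Suc i) then 1 else 0)"
proof -
  define P where "P = perm_inv (snd g)"
  let ?S = "{m. 1 \<le> m \<and> m < i \<and> P i < P m}"
  have fin: "finite ?S" by (rule finite_subset[of _ "{..<i}"]) auto
  have "{m. 1 \<le> m \<and> m < Suc i \<and> P i < P (transpose i (Suc i) m)}
    = (if P i < P (Suc i) then insert i ?S else ?S)"
    using assms(2) by (auto simp: transpose_def less_Suc_eq split: if_splits)
  then have "card {m. 1 \<le> m \<and> m < Suc i \<and> P i < P (transpose i (Suc i) m)}
    = card ?S + (if P i < P (Suc i) then 1 else 0)"
    using fin by simp
  then show ?thesis
    using assms(1) by (simp add: l_stat_def swap_digits_def perm_inv_swap P_def)
qed

lemma swap_digits_swap_digits [simp]: "swap_digits i (swap_digits i g) = g"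
  by (simp add: swap_digits_def o_assoc[symmetric] fun_eq_iff prod_eq_iff)

lemma bij_snd_swap_digits: "bij (snd g) \<Longrightarrow> bij (snd (swap_digits i g))"
  by (simp add: swap_digits_def bij_comp)

lemma perm_inv_snd_swap_digits:
  assumes "bij (snd g)"
  shows "perm_inv (snd (swap_digits i g)) = perm_inv (snd g) \<circ> transpose i (Suc i)"
  using assms by (simp add: swap_digits_def perm_inv_swap)

text \<open>The previous relation for the swapped element; this form avoids subtraction in
  \<open>nat\<close>.\<close>

lemma l_stat_swap_digits_same:
  assumes "bij (snd g)" "i \<ge> 1"
  shows "l_stat g (Suc i) = l_stat (swap_digits i g) i
    + (if perm_inv (snd g) (Suc i) < perm_inv (snd g) i then 1 else 0)"
  using l_stat_swap_digits_Suc[OF bij_snd_swap_digits[OF assms(1)] assms(2), of i]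
  by (simp add: perm_inv_snd_swap_digits assms(1))

lemma sum_split_Suc:
  fixes f :: "nat \<Rightarrow> 'a::comm_monoid_add"
  assumes "1 \<le> i" "i < n"
  shows "(\<Sum>j=1..n. f j) = f i + f (Suc i) + (\<Sum>j\<in>{1..n} - {i, Suc i}. f j)"
proof -
  have "{1..n} = insert i (insert (Suc i) ({1..n} - {i, Suc i}))" using assms by auto
  then have "(\<Sum>j=1..n. f j) = (\<Sum>j\<in>insert i (insert (Suc i) ({1..n} - {i, Suc i})). f j)" by simp
  then show ?thesis by (simp add: add.assoc)
qed

lemma perm_inv_neq:
  assumes "bij \<tau>"
  shows "perm_inv \<tau> i \<noteq> perm_inv \<tau> (Suc i)"
proof -
  have "inj (perm_inv \<tau>)" using assms by (simp add: perm_inv_def bij_imp_bij_inv bij_is_inj)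
  then show ?thesis by (simp add: inj_eq)
qed

text \<open>Colours are merely permuted, while exactly one of the two 0-1 corrections to
  \<open>l_stat\<close> is 1, as \<open>i\<close> and \<open>Suc i\<close> have different
  places.\<close>

lemma parity_sum_swap_digits:
  assumes "bij (snd g)" "1 \<le> i" "i < n"
  shows "even (parity_sum n (swap_digits i g)) \<longleftrightarrow> odd (parity_sum n g)"
proof -
  have "(\<Sum>j\<in>{1..n} - {i, Suc i}. l_stat (swap_digits i g) j)
      = (\<Sum>j\<in>{1..n} - {i, Suc i}. l_stat g j)"
    using assms by (intro sum.cong) (auto simp: l_stat_swap_digits_other)
  moreover have "(\<Sum>j\<in>{1..n} - {i, Suc i}. fst (swap_digits i g) j)
      = (\<Sum>j\<in>{1..n} - {i, Suc i}. fst g j)"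
    using assms by (intro sum.cong) (auto simp: swap_digits_def)
  moreover have "fst (swap_digits i g) i = fst g (Suc i)" "fst (swap_digits i g) (Suc i) = fst g i"
    by (simp_all add: swap_digits_def)
  ultimately show ?thesis
    using l_stat_swap_digits_Suc[OF assms(1,2)] l_stat_swap_digits_same[OF assms(1,2)]
      perm_inv_neq[OF assms(1), of i]
    unfolding parity_sum_def sum_split_Suc[OF assms(2,3)] by (auto split: if_splits)
qed

text \<open>Moving up from \<open>i\<close> costs 0 or 1 for colour 0 and 2 or 1 otherwise, with 1
  when \<open>i\<close> stands before \<open>Suc i\<close>. Moving down from \<open>Suc i\<close>
  saves 0 or 1 and 2 or 1 likewise, with 1 when \<open>Suc i\<close> stands first. The four colour
  patterns give the cases.\<close>

lemma weight_swap_digits: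
  assumes "bij (snd g)" "1 \<le> i" "i < n"
  shows "weight r n (swap_digits i g) = weight r n g
    + (if fst g (Suc i) \<noteq> 0 \<and> (fst g i = 0 \<or> perm_inv (snd g) i < perm_inv (snd g) (Suc i)) \<or>
          fst g i = 0 \<and> perm_inv (snd g) (Suc i) < perm_inv (snd g) i then -1 else 1)"
proof -
  have "(\<Sum>j\<in>{1..n} - {i, Suc i}. digit_weight r (swap_digits i g) j)
      = (\<Sum>j\<in>{1..n} - {i, Suc i}. digit_weight r g j)"
    using assms
    by (intro sum.cong) (auto simp: digit_weight_def l_stat_swap_digits_other, auto simp: swap_digits_def)
  moreover have "fst (swap_digits i g) i = fst g (Suc i)" "fst (swap_digits i g) (Suc i) = fst g i"
    by (simp_all add: swap_digits_def)
  ultimately show ?thesis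
    using l_stat_swap_digits_Suc[OF assms(1,2)] l_stat_swap_digits_same[OF assms(1,2)]
      perm_inv_neq[OF assms(1), of i]
    unfolding weight_def sum_split_Suc[OF assms(2,3)]
    by (simp add: digit_weight_def split: if_splits)
qed

lemma group_sign_group: "group sign_group"
  by (rule groupI) (auto simp: sign_group_def)

lemma sign_group_pow: "x [^]\<^bsub>sign_group\<^esub> (t::nat) = x ^ t"
  by (induction t) (simp_all add: sign_group_def nat_pow_def)

lemma fls_X_intpow_sum:
  "fls_X_intpow (\<Sum>i\<in>S. f i) = (\<Prod>i\<in>S. (fls_X_intpow (f i) :: 'a::comm_semiring_1 fls))"
proof (induction S rule: infinite_finite_induct)
  case (insert x F)
  have "fls_X_intpow (f x + sum f F) = fls_X_intpow (f x) * (fls_X_intpow (sum f F) :: 'a fls)"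
    by (rule fls_X_intpow_times_fls_X_intpow[symmetric])
  then show ?case
    unfolding sum.insert[OF insert.hyps] prod.insert[OF insert.hyps] insert.IH .
qed simp_all

section \<open>Generators acting as elementary moves\<close>

locale coloured_cover =
  fixes r n :: nat
  assumes r: "r mod 4 = 2" and n: "n > 0"
begin

lemma even_r: "even r" and r_ge_2: "r \<ge> 2" and odd_half: "odd (r div 2)"
  and half_add_half: "r div 2 + r div 2 = r"
  using r by presburger+

sublocale GG: group "G r n"
  using group_G r_ge_2 by simp

lemma carrier_iff:
  "g \<in> carrier (G r n) \<longleftrightarrow>
    (\<forall>i\<in>{1..n}. fst g i < r) \<and> (\<forall>i. i \<notin> {1..n} \<longrightarrow> fst g i = 0) \<and> snd g permutes {1..n}"
  by (cases g) (simp add: G_def)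

lemma color_less: "g \<in> carrier (G r n) \<Longrightarrow> fst g i < r"
  using r_ge_2 by (cases "i \<in> {1..n}") (auto simp: carrier_iff)

lemma bij_snd: "g \<in> carrier (G r n) \<Longrightarrow> bij (snd g)"
  by (auto simp: carrier_iff intro: permutes_bij)

lemma recolor_one_closed: "g \<in> carrier (G r n) \<Longrightarrow> recolor_one r t g \<in> carrier (G r n)"
  using n r_ge_2 by (auto simp: carrier_iff recolor_one_def)

lemma swap_digits_closed:
  assumes "g \<in> carrier (G r n)" "1 \<le> i" "i < n"
  shows "swap_digits i g \<in> carrier (G r n)"
proof -
  have t: "transpose i (Suc i) permutes {1..n}" using assms by (intro permutes_swap_id) auto
  then have "transpose i (Suc i) j \<in> {1..n} \<longleftrightarrow> j \<in> {1..n}" for j by (rule permutes_in_image)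
  then show ?thesis
    using assms t by (auto simp: carrier_iff swap_digits_def color_less intro: permutes_compose)
qed

lemma recolor_one_add:
  assumes "g \<in> carrier (G r n)" "(t + u) mod r = 0"
  shows "recolor_one r t (recolor_one r u g) = g"
proof -
  have "(fst g 1 + u + t) mod r = (fst g 1 + (t + u) mod r) mod r"
    by (simp add: mod_simps add_ac)
  also have "\<dots> = fst g 1" using color_less[OF assms(1)] assms(2) by simp
  finally show ?thesis by (simp add: recolor_one_def prod_eq_iff fun_eq_iff mod_simps)
qed

lemma recolor_half_half:
  "g \<in> carrier (G r n) \<Longrightarrow> recolor_one r (r div 2) (recolor_one r (r div 2) g) = g"
  by (rule recolor_one_add) (simp_all add: half_add_half)

lemma l_stat_recolor_one [simp]: "l_stat (recolor_one r t g) = l_stat g"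
  by (simp add: l_stat_def recolor_one_def fun_eq_iff)

lemma sum_head: "(\<Sum>i=Suc 0..n. f i) = f (Suc 0) + (\<Sum>i=2..n. f i)" for f :: "nat \<Rightarrow> 'b::comm_monoid_add"
  using n by (simp add: sum.atLeast_Suc_atMost numeral_2_eq_2)

lemma parity_sum_recolor_one:
  "even (parity_sum n (recolor_one r t g)) \<longleftrightarrow> even (parity_sum n g + t)"
proof -
  have "(\<Sum>i=2..n. fst (recolor_one r t g) i) = (\<Sum>i=2..n. fst g i)"
    by (intro sum.cong) (auto simp: recolor_one_def)
  moreover have "fst (recolor_one r t g) 1 = (fst g 1 + t) mod r" by (simp add: recolor_one_def)
  moreover have "even ((fst g 1 + t) mod r) \<longleftrightarrow> even (fst g 1 + t)" using even_r by (simp add: dvd_mod_iff)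
  ultimately show ?thesis by (simp add: parity_sum_def sum_head[of "fst _"]) auto
qed

lemma digit_weight_one: "digit_weight r g (Suc 0) = int (half_res r (fst g (Suc 0)))"
  by (simp add: digit_weight_def)

lemma weight_recolor_one:
  "weight r n (recolor_one r t g)
    = weight r n g - int (half_res r (fst g 1)) + int (half_res r (fst g 1 + t))"
proof -
  have "(\<Sum>i=2..n. digit_weight r (recolor_one r t g) i) = (\<Sum>i=2..n. digit_weight r g i)"
    by (intro sum.cong) (auto simp: digit_weight_def, auto simp: recolor_one_def)
  moreover have "fst (recolor_one r t g) 1 = (fst g 1 + t) mod r" by (simp add: recolor_one_def)
  ultimately show ?thesis
    by (simp add: weight_def sum_head digit_weight_one half_res_mod even_r)
qed

text \<open>Makes the power of \<open>s_gen r 0\<close> inside \<open>a_gen r n i\<close>,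
  \<open>i \<ge> 1\<close>, invisible to the weight; it only repairs the parity changed by the
  swap.\<close>

lemma weight_recolor_half: "weight r n (recolor_one r (r div 2) g) = weight r n g"
  by (simp add: weight_recolor_one half_res_add_half r)

lemma s_gen_closed: "i < n \<Longrightarrow> s_gen r i \<in> carrier (G r n)"
  using n r_ge_2 by (auto simp: carrier_iff s_gen_def permutes_id intro!: permutes_swap_id)

lemma s_gen_0_pow: "s_gen r 0 [^]\<^bsub>G r n\<^esub> t = ((\<lambda>j. if j = 1 then t mod r else 0), id)"
proof (induction t)
  case 0
  then show ?case by (auto simp: G_def)
next
  case (Suc t)
  then show ?case
    by (auto simp: G_def s_gen_def perm_inv_def mod_simps fun_eq_iff)
qed

lemma s_gen_0_pow_mult:
  assumes "g \<in> carrier (G r n)"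
  shows "s_gen r 0 [^]\<^bsub>G r n\<^esub> t \<otimes>\<^bsub>G r n\<^esub> g = recolor_one r t g"
  using color_less[OF assms] unfolding s_gen_0_pow
  by (cases g) (auto simp: G_def recolor_one_def perm_inv_def mod_simps fun_eq_iff add_ac)

lemma s_gen_mult:
  assumes "g \<in> carrier (G r n)" "1 \<le> i"
  shows "s_gen r i \<otimes>\<^bsub>G r n\<^esub> g = swap_digits i g"
  using color_less[OF assms(1)] assms(2)
  by (cases g) (auto simp: G_def swap_digits_def s_gen_def perm_inv_def fun_eq_iff)

lemma a_gen_closed: "i < n \<Longrightarrow> a_gen r n i \<in> carrier (G r n)"
  using s_gen_closed n by (auto simp: a_gen_def)

lemma a_gen_0_mult: "g \<in> carrier (G r n) \<Longrightarrow> a_gen r n 0 \<otimes>\<^bsub>G r n\<^esub> g = recolor_one r 2 g"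
  by (simp add: a_gen_def s_gen_0_pow_mult del: One_nat_def)

lemma a_gen_mult:
  assumes "g \<in> carrier (G r n)" "1 \<le> i" "i < n"
  shows "a_gen r n i \<otimes>\<^bsub>G r n\<^esub> g = recolor_one r (r div 2) (swap_digits i g)"
proof -
  have "a_gen r n i \<otimes>\<^bsub>G r n\<^esub> g
      = s_gen r 0 [^]\<^bsub>G r n\<^esub> (r div 2) \<otimes>\<^bsub>G r n\<^esub> (s_gen r i \<otimes>\<^bsub>G r n\<^esub> g)"
    using assms s_gen_closed[of 0] s_gen_closed[of i] n by (simp add: a_gen_def GG.m_assoc)
  then show ?thesis
    using assms by (simp add: s_gen_mult s_gen_0_pow_mult swap_digits_closed)
qed

text \<open>For \<open>i \<ge> 2\<close> recolouring 1 commutes with the swap and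
  \<open>a_gen r n i\<close> is an involution; at \<open>i = 1\<close> it does not commute, and the
  inverse recolours before swapping.\<close>

lemma inv_a_gen_1_mult:
  assumes "g \<in> carrier (G r n)" "1 < n"
  shows "inv\<^bsub>G r n\<^esub> (a_gen r n 1) \<otimes>\<^bsub>G r n\<^esub> g = swap_digits 1 (recolor_one r (r div 2) g)"
proof -
  let ?h = "swap_digits 1 (recolor_one r (r div 2) g)"
  have h: "?h \<in> carrier (G r n)" using assms by (simp add: swap_digits_closed recolor_one_closed)
  have "a_gen r n 1 \<otimes>\<^bsub>G r n\<^esub> ?h = g"
    using a_gen_mult[OF h, of 1] assms by (simp add: recolor_half_half)
  then show ?thesis using h assms a_gen_closed[of 1] GG.inv_solve_left[of "?h" "a_gen r n 1" g] by simp
qed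

lemma weight_one: "weight r n \<one>\<^bsub>G r n\<^esub> = 0" and parity_sum_one: "parity_sum n \<one>\<^bsub>G r n\<^esub> = 0"
proof -
  have "{j. 1 \<le> j \<and> j < i \<and> i < j} = {}" for i :: nat by auto
  then have "l_stat \<one>\<^bsub>G r n\<^esub> i = 0" for i
    unfolding l_stat_def by (simp add: G_def perm_inv_def)
  then show "weight r n \<one>\<^bsub>G r n\<^esub> = 0" "parity_sum n \<one>\<^bsub>G r n\<^esub> = 0"
    by (simp_all add: weight_def digit_weight_def parity_sum_def) (simp_all add: G_def)
qed

section \<open>Weight equals length\<close>

text \<open>The weight drops by reducing the halved colour of 1 or by a suitable swap. If neither is
  possible, colour 0 spreads upwards from the digit 1 along increasing places, which leaves only the
  identity.\<close>

lemma descent: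
  assumes g: "g \<in> carrier (G r n)" and even: "even (parity_sum n g)" and ne: "g \<noteq> \<one>\<^bsub>G r n\<^esub>"
  obtains a g' where "a \<in> A_gens r n" "g' \<in> carrier (G r n)" "even (parity_sum n g')"
    "g = a \<otimes>\<^bsub>G r n\<^esub> g'" "weight r n g = weight r n g' + 1"
proof -
  let ?k = "r div 2"
  define f where "f = recolor_one r ?k g"
  have f: "f \<in> carrier (G r n)" "weight r n f = weight r n g" "odd (parity_sum n f)"
    "recolor_one r ?k f = g"
    using g even odd_half
    by (auto simp: f_def recolor_one_closed weight_recolor_half parity_sum_recolor_one recolor_half_half)
  define D where "D h i \<longleftrightarrow> weight r n (swap_digits i h) = weight r n h - 1" for h i
  \<comment> \<open>Since \<open>a\<^sub>1\<close> and \<open>a\<^sub>1\<inverse>\<close> are both available, the descent at \<open>i = 1\<close> may be tested on \<open>g\<close> or on \<open>f\<close>,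
    whichever gives the digit \<open>1\<close> colour \<open>0\<close>.\<close>
  consider (zero) "half_res r (fst g 1) \<noteq> 0" | (swap) i where "1 \<le> i" "i < n" "D f i"
    | (swap_inv) "1 < n" "D g 1"
    | (none) "half_res r (fst g 1) = 0" "\<And>i. 1 \<le> i \<Longrightarrow> i < n \<Longrightarrow> \<not> D f i" "1 < n \<Longrightarrow> \<not> D g 1"
    by blast
  then show thesis
  proof cases
    case zero
    define g' where "g' = recolor_one r (r - 2) g"
    have "2 + (r - 2) = r" using r_ge_2 by simp
    then have "(2 + (r - 2)) mod r = 0" by simp
    then have gg': "recolor_one r 2 g' = g" unfolding g'_def by (rule recolor_one_add[OF g])
    have g': "g' \<in> carrier (G r n)" using g by (simp add: g'_def recolor_one_closed)
    have par: "even (parity_sum n g')" using even even_r by (simp add: g'_def parity_sum_recolor_one)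
    have "fst g 1 = (fst g' 1 + 2) mod r" using gg' by (auto simp: recolor_one_def)
    then have hr: "half_res r (fst g 1) = (half_res r (fst g' 1) + 1) mod ?k"
      by (simp only: half_res_mod[OF even_r] half_res_add_2[OF r])
    have less: "half_res r (fst g' 1) < ?k" using half_res_less r_ge_2 by blast
    \<comment> \<open>Reaching \<open>r div 2\<close> would wrap the halved colour to 0, which this
      case excludes.\<close>
    have "half_res r (fst g' 1) + 1 \<noteq> ?k" using hr zero by auto
    then have "half_res r (fst g 1) = half_res r (fst g' 1) + 1" using hr less by simp
    moreover have "weight r n g = weight r n g' - int (half_res r (fst g' 1)) + int (half_res r (fst g 1))"
      using weight_recolor_one[of 2 g'] \<open>fst g 1 = _\<close> by (simp only: gg' half_res_mod[OF even_r])
    ultimately have "weight r n g = weight r n g' + 1" by simp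
    moreover have "g = a_gen r n 0 \<otimes>\<^bsub>G r n\<^esub> g'" using gg' g' by (simp add: a_gen_0_mult)
    moreover have "a_gen r n 0 \<in> A_gens r n" using n by (auto simp: A_gens_def)
    ultimately show thesis using that g' par by blast
  next
    case swap
    \<comment> \<open>\<open>a_gen r n i\<close> swaps first and recolours last, so undoing it
      starts from \<open>f\<close>.\<close>
    define g' where "g' = swap_digits i f"
    have g': "g' \<in> carrier (G r n)" using f(1) swap by (simp add: g'_def swap_digits_closed)
    have "even (parity_sum n g')"
      using parity_sum_swap_digits[of f i n] f swap bij_snd by (simp add: g'_def)
    moreover have "a_gen r n i \<otimes>\<^bsub>G r n\<^esub> g' = g"
      using swap g' f by (simp add: a_gen_mult, simp add: g'_def)
    moreover have "a_gen r n i \<in> A_gens r n" using swap by (auto simp: A_gens_def)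
    moreover have "weight r n g = weight r n g' + 1" using swap f by (simp add: g'_def D_def)
    ultimately show thesis using that g' by blast
  next
    case swap_inv
    define g' where "g' = recolor_one r ?k (swap_digits 1 g)"
    have sg: "swap_digits 1 g \<in> carrier (G r n)" using g swap_inv by (simp add: swap_digits_closed)
    then have g': "g' \<in> carrier (G r n)" by (simp add: g'_def recolor_one_closed)
    have "even (parity_sum n g')"
      using parity_sum_swap_digits[of g 1 n] even odd_half swap_inv bij_snd[OF g]
      by (simp add: g'_def parity_sum_recolor_one)
    moreover have "inv\<^bsub>G r n\<^esub> (a_gen r n 1) \<otimes>\<^bsub>G r n\<^esub> g' = g"
      using inv_a_gen_1_mult[OF g'] swap_inv sg by (simp add: g'_def recolor_half_half)
    moreover have "inv\<^bsub>G r n\<^esub> (a_gen r n 1) \<in> A_gens r n" using swap_inv by (auto simp: A_gens_def)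
    moreover have "weight r n g = weight r n g' + 1"
      using swap_inv by (simp add: g'_def D_def weight_recolor_half)
    ultimately show thesis using that g' by blast
  next
    case none
    \<comment> \<open>Halved colour 0 leaves the colours 0 and \<open>r div 2\<close>, which
      recolouring by \<open>r div 2\<close> interchanges.\<close>
    have "fst g 1 = (if odd (fst g 1) then ?k else 0) mod r"
      using double_half_res[OF r color_less[OF g, of 1]] none(1) by simp
    then have g1: "fst g 1 = 0 \<or> fst f 1 = 0"
      using half_add_half r_ge_2 by (auto simp: f_def recolor_one_def mod_less split: if_splits)
    \<comment> \<open>Such swaps avoid the digit 1, the only one where \<open>f\<close> and
      \<open>g\<close> differ.\<close>
    have Dfg: "D g i \<longleftrightarrow> D f i" if "2 \<le> i" "i < n" for i
      using that f(2) weight_swap_digits[of g i n r] weight_swap_digits[of f i n r]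
        bij_snd[OF g] bij_snd[OF f(1)]
      by (simp add: D_def f_def recolor_one_def)
    obtain h where h: "h = g \<or> h = f" "fst h 1 = 0" using g1 by blast
    have hc: "h \<in> carrier (G r n)" using h g f by auto
    have nD: "\<not> D h i" if "1 \<le> i" "i < n" for i
      using that none Dfg[of i] h by (cases "i = 1") auto
    let ?P = "perm_inv (snd h)"
    \<comment> \<open>For \<open>i\<close> of colour 0, \<open>weight_swap_digits\<close> gives a
      descent unless \<open>Suc i\<close> has colour 0 and stands to the right of
      \<open>i\<close>.\<close>
    have succ: "fst h (Suc i) = 0 \<and> ?P i < ?P (Suc i)" if "1 \<le> i" "i < n" "fst h i = 0" for i
      using nD[OF that(1,2)] weight_swap_digits[OF bij_snd[OF hc] that(1,2), of r] that(3)
        perm_inv_neq[OF bij_snd[OF hc], of i]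
      by (auto simp: D_def split: if_splits)
    have Pp: "?P permutes {1..n}" using hc by (simp add: carrier_iff perm_inv_def permutes_inv)
    \<comment> \<open>Starting at \<open>?P 1 \<ge> 1\<close>, strict increase carries
      \<open>i \<le> ?P i\<close> upwards.\<close>
    have ind: "i \<le> n \<Longrightarrow> fst h i = 0 \<and> i \<le> ?P i" if "1 \<le> i" for i
      using that
    proof (induction i rule: dec_induct)
      case base
      then show ?case using h permutes_in_image[OF Pp, of 1] by simp
    next
      case (step i)
      then show ?case using succ[of i] by simp
    qed
    have "?P = id" by (rule permutes_natset_ge[OF Pp]) (use ind in auto)
    then have "snd h = id"
      using bij_snd[OF hc] by (metis inv_id inv_inv_eq perm_inv_def)
    moreover have "fst h = (\<lambda>_. 0)"
    proof
      fix i
      have "fst h i = 0" if "i \<notin> {1..n}" using that hc carrier_iff by blast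
      then show "fst h i = 0" using ind[of i] by (cases "i \<in> {1..n}") simp_all
    qed
    ultimately have one: "h = \<one>\<^bsub>G r n\<^esub>" by (simp add: G_def prod_eq_iff)
    \<comment> \<open>The identity is even and \<open>f\<close> is odd, so \<open>h\<close> is
      \<open>g\<close>, against the assumption on \<open>g\<close>.\<close>
    then have "h \<noteq> f" using f(3) by (auto simp: parity_sum_one)
    then show thesis using h one ne by blast
  qed
qed

lemma A_gens_mult:
  assumes "a \<in> A_gens r n" "g \<in> carrier (G r n)"
  shows "a \<otimes>\<^bsub>G r n\<^esub> g \<in> carrier (G r n) \<and> weight r n (a \<otimes>\<^bsub>G r n\<^esub> g) \<le> weight r n g + 1 \<and>
    (even (parity_sum n (a \<otimes>\<^bsub>G r n\<^esub> g)) \<longleftrightarrow> even (parity_sum n g))"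
proof -
  consider "a = a_gen r n 0" | i where "a = a_gen r n i" "1 \<le> i" "i < n"
    | "a = inv\<^bsub>G r n\<^esub> (a_gen r n 1)" "1 < n"
  proof -
    from assms(1) consider i where "a = a_gen r n i" "i < n"
      | "a = inv\<^bsub>G r n\<^esub> (a_gen r n 1)" "1 < n"
      by (auto simp: A_gens_def)
    then show thesis
    proof cases
      case (1 i)
      then show thesis using that(1,2) by (cases "i = 0") auto
    qed (use that(3) in blast)
  qed
  then show ?thesis
  proof cases
    case 1
    \<comment> \<open>The halved colour grows by one or wraps round to 0; it may drop far but never
      rises by more than one.\<close>
    have "half_res r (fst g 1 + 2) \<le> half_res r (fst g 1) + 1"
      unfolding half_res_add_2[OF r] by (rule mod_less_eq_dividend)
    then show ?thesis
      using 1 assms(2) by (simp add: a_gen_0_mult recolor_one_closed weight_recolor_one parity_sum_recolor_one)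
  next
    case 2
    have "weight r n (swap_digits i g) \<le> weight r n g + 1"
      using weight_swap_digits[OF bij_snd[OF assms(2)] 2(2,3), of r] by simp
    then show ?thesis
      using 2 assms(2) odd_half parity_sum_swap_digits[OF bij_snd[OF assms(2)] 2(2,3)]
      by (simp add: a_gen_mult recolor_one_closed swap_digits_closed weight_recolor_half
          parity_sum_recolor_one)
  next
    case 3
    define f where "f = recolor_one r (r div 2) g"
    have f: "f \<in> carrier (G r n)" "weight r n f = weight r n g"
      "even (parity_sum n f) \<longleftrightarrow> odd (parity_sum n g)"
      using assms(2) odd_half
      by (auto simp: f_def recolor_one_closed weight_recolor_half parity_sum_recolor_one)
    have "weight r n (swap_digits 1 f) \<le> weight r n f + 1"
      using weight_swap_digits[OF bij_snd[OF f(1)] _ 3(2), of r] by simp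
    moreover have "a \<otimes>\<^bsub>G r n\<^esub> g = swap_digits 1 f"
      using 3 inv_a_gen_1_mult[OF assms(2)] by (simp add: f_def)
    ultimately show ?thesis
      using 3 f swap_digits_closed[OF f(1), of 1] parity_sum_swap_digits[OF bij_snd[OF f(1)] _ 3(2)] by simp
  qed
qed

text \<open>Upper bound on the length: \<open>descent\<close> peels off one generator per unit of
  weight.\<close>

lemma exists_word:
  assumes "g \<in> carrier (G r n)" "even (parity_sum n g)"
  shows "\<exists>ws. int (length ws) = weight r n g \<and> set ws \<subseteq> A_gens r n \<and>
    foldr (monoid.mult (G r n)) ws \<one>\<^bsub>G r n\<^esub> = g"
  using assms
proof (induction "nat (weight r n g)" arbitrary: g rule: less_induct)
  case less
  show ?case
  proof (cases "g = \<one>\<^bsub>G r n\<^esub>")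
    case True
    then show ?thesis by (intro exI[of _ "[]"]) (simp add: weight_one)
  next
    case False
    obtain a g' where a: "a \<in> A_gens r n" "g' \<in> carrier (G r n)" "even (parity_sum n g')"
        "g = a \<otimes>\<^bsub>G r n\<^esub> g'" "weight r n g = weight r n g' + 1"
      using descent[OF less.prems False] by metis
    then have "nat (weight r n g') < nat (weight r n g)" using weight_nonneg[of r n g'] by simp
    then obtain ws where "int (length ws) = weight r n g'" "set ws \<subseteq> A_gens r n"
        "foldr (monoid.mult (G r n)) ws \<one>\<^bsub>G r n\<^esub> = g'"
      using less.hyps a(2,3) by blast
    then show ?thesis using a by (intro exI[of _ "a # ws"]) simp
  qed
qed

text \<open>Lower bound on the length: the identity has weight 0 and each letter adds at most
  one.\<close>

lemma weight_word:
  assumes "set ws \<subseteq> A_gens r n"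
  shows "foldr (monoid.mult (G r n)) ws \<one>\<^bsub>G r n\<^esub> \<in> carrier (G r n) \<and>
    weight r n (foldr (monoid.mult (G r n)) ws \<one>\<^bsub>G r n\<^esub>) \<le> int (length ws)"
  using assms
proof (induction ws)
  case Nil
  then show ?case by (simp add: weight_one)
next
  case (Cons a ws)
  then show ?case using A_gens_mult[of a "foldr (monoid.mult (G r n)) ws \<one>\<^bsub>G r n\<^esub>"] by auto
qed

lemma len_A_eq_weight:
  assumes "g \<in> carrier (G r n)" "even (parity_sum n g)"
  shows "int (len_A r n g) = weight r n g"
proof -
  obtain ws where ws: "int (length ws) = weight r n g" "set ws \<subseteq> A_gens r n"
    "foldr (monoid.mult (G r n)) ws \<one>\<^bsub>G r n\<^esub> = g"
    using exists_word[OF assms] by blast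
  have "len_A r n g = length ws"
    unfolding len_A_def
  proof (rule Least_equality)
    fix u assume "\<exists>ws. length ws = u \<and> set ws \<subseteq> A_gens r n \<and>
      foldr (monoid.mult (G r n)) ws \<one>\<^bsub>G r n\<^esub> = g"
    then have "weight r n g \<le> int u" using weight_word by blast
    then show "length ws \<le> u" using ws(1) by simp
  qed (use ws in blast)
  then show ?thesis using ws(1) by simp
qed

section \<open>\<open>A r n\<close> as the set of even elements\<close>

lemma alt_hom: "alt_hom r n \<in> hom (G r n) sign_group" "i < n \<Longrightarrow> alt_hom r n (s_gen r i) = -1"
  using someI_ex[OF alt_hom_exists[OF even_r, of n]] r_ge_2 unfolding alt_hom_def by auto

sublocale alt: group_hom "G r n" sign_group "alt_hom r n"
  by (intro group_hom.intro group_hom_axioms.intro GG.group_axioms group_sign_group alt_hom)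

text \<open>On even elements \<open>alt_hom\<close> is trivial because they are words in \<open>A_gens\<close>; no uniqueness of the
  sign homomorphism is needed.\<close>

lemma alt_hom_A_gens:
  assumes "a \<in> A_gens r n"
  shows "alt_hom r n a = 1"
proof -
  have "alt_hom r n (a_gen r n i) = 1" if "i < n" for i
    using that n s_gen_closed[of 0] s_gen_closed[of i] odd_half alt_hom(2)[of 0] alt_hom(2)[of i]
    by (simp add: a_gen_def alt.hom_nat_pow sign_group_pow, simp add: sign_group_def)
  then show ?thesis
    using assms a_gen_closed alt.H.inv_one by (auto simp: A_gens_def alt.hom_inv sign_group_def)
qed

lemma alt_hom_eq_1:
  assumes "g \<in> carrier (G r n)" "even (parity_sum n g)"
  shows "alt_hom r n g = 1"
proof -
  have "set ws \<subseteq> A_gens r n \<Longrightarrow> alt_hom r n (foldr (monoid.mult (G r n)) ws \<one>\<^bsub>G r n\<^esub>) = 1" for ws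
  proof (induction ws)
    case Nil
    then show ?case using alt.hom_one by (simp add: sign_group_def)
  next
    case (Cons a ws)
    have "a \<in> carrier (G r n)"
      using A_gens_mult[of a "\<one>\<^bsub>G r n\<^esub>"] Cons.prems a_gen_closed by (auto simp: A_gens_def)
    then show ?case
      using Cons alt_hom_A_gens weight_word[of ws] by (simp add: alt.hom_mult) (simp add: sign_group_def)
  qed
  then show ?thesis using exists_word[OF assms] by blast
qed

text \<open>Replaces the kernel of a chosen homomorphism by an explicit parity. An odd element
  becomes even after multiplication by \<open>s_gen r 0\<close>, where \<open>alt_hom\<close> is -1,
  so its own value cannot be 1.\<close>

lemma A_iff: "g \<in> A r n \<longleftrightarrow> g \<in> carrier (G r n) \<and> even (parity_sum n g)"
proof (cases "g \<in> carrier (G r n) \<and> odd (parity_sum n g)")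
  case True
  let ?f = "s_gen r 0 \<otimes>\<^bsub>G r n\<^esub> g"
  have "?f = recolor_one r 1 g"
    using s_gen_0_pow_mult[of g 1] True s_gen_closed[of 0] n by simp
  then have "alt_hom r n ?f = 1"
    using True by (intro alt_hom_eq_1) (simp_all add: recolor_one_closed parity_sum_recolor_one)
  then have "alt_hom r n g \<noteq> 1"
    using True alt_hom(2)[of 0] n s_gen_closed[of 0] by (simp add: alt.hom_mult) (simp add: sign_group_def)
  then show ?thesis using True by (simp add: A_def kernel_def sign_group_def)
next
  case False
  then show ?thesis using alt_hom_eq_1[of g] by (auto simp: A_def kernel_def sign_group_def)
qed

section \<open>Fibres of \<open>cover\<close> and their generating function\<close>

text \<open>\<open>b i\<close> selects one of the two lifts of the halved colour of
  \<open>i\<close>, and is the parity of that lift.\<close>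

definition fibre_point :: "cperm \<Rightarrow> (nat \<Rightarrow> bool) \<Rightarrow> cperm"
  where "fibre_point \<pi> b =
    (\<lambda>i. (2 * half_res r (fst \<pi> i) + (if b i then r div 2 else 0)) mod r, snd \<pi>)"

lemma odd_fibre_point: "odd (fst (fibre_point \<pi> b) i) \<longleftrightarrow> b i"
  using even_r odd_half by (simp add: fibre_point_def dvd_mod_iff)

lemma l_stat_fibre_point [simp]: "l_stat (fibre_point \<pi> b) = l_stat \<pi>"
  by (simp add: fibre_point_def l_stat_def fun_eq_iff)

lemma cover_fibre_point: "cover r (fibre_point \<pi> b) = cover r \<pi>"
  using half_res_double[OF r half_res_less[OF r_ge_2]]
  by (cases \<pi>) (simp add: cover_def fibre_point_def)

lemma fibre_point_odd_colors:
  assumes "\<sigma> \<in> carrier (G r n)" "cover r \<sigma> = cover r \<pi>"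
  shows "fibre_point \<pi> (\<lambda>i. odd (fst \<sigma> i)) = \<sigma>"
proof -
  have "half_res r (fst \<pi> i) = half_res r (fst \<sigma> i)" for i
    using assms(2) by (cases \<sigma>; cases \<pi>) (simp add: cover_def fun_eq_iff)
  moreover have "snd \<sigma> = snd \<pi>" using assms(2) by (cases \<sigma>; cases \<pi>) (simp add: cover_def)
  ultimately show ?thesis
    using double_half_res[OF r color_less[OF assms(1)]] by (simp add: fibre_point_def prod_eq_iff)
qed

lemma fibre_point_in_A:
  assumes "\<pi> \<in> carrier (G r n)" "\<And>i. b i \<Longrightarrow> i \<in> {1..n}"
  shows "fibre_point \<pi> b \<in> A r n \<longleftrightarrow> even (card {i. b i} + inv_number n (snd \<pi>))"
proof -
  have "fibre_point \<pi> b \<in> carrier (G r n)"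
    using assms r_ge_2 by (auto simp: carrier_iff fibre_point_def)
  moreover have "{i \<in> {1..n}. b i} = {i. b i}" using assms(2) by auto
  moreover have "(\<Sum>i=1..n. l_stat \<pi> i) = inv_number n (snd \<pi>)"
    using sum_l_stat_eq_inv_number[of "snd \<pi>" n "fst \<pi>"] assms(1) by (simp add: carrier_iff)
  ultimately show ?thesis
    by (simp add: A_iff parity_sum_def even_sum_iff odd_fibre_point)
qed

text \<open>Places the section in the same parametrization as the fibre: it is odd at most at the
  digit 1.\<close>

lemma cover_section_cover:
  "cover_section r n (cover r \<pi>) = fibre_point \<pi> (\<lambda>i. i = 1 \<and> odd (inv_number n (snd \<pi>)))"
  by (cases \<pi>) (simp add: cover_section_def cover_def fibre_point_def)

lemma half_res_eq_0_iff:
  assumes "c < r"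
  shows "half_res r c = 0 \<longleftrightarrow> c \<in> {0, r div 2}"
proof -
  have "half_res r (r div 2) = 0" using half_res_add_half[OF r, of 0] by simp
  moreover have "c \<in> {0, r div 2}" if "half_res r c = 0"
    using double_half_res[OF r assms] that r_ge_2 by (auto simp: mod_less split: if_splits)
  ultimately show ?thesis by auto
qed

text \<open>A nonzero halved colour has two nonzero lifts of equal weight. Halved colour 0 lifts to
  0 and \<open>r div 2\<close>, of weights \<open>l_stat \<pi> i\<close> and
  \<open>2 * (i - 1) - l_stat \<pi> i\<close>; \<open>delta\<close> detects this case.\<close>

lemma digit_weight_fibre_point:
  assumes "\<pi> \<in> carrier (G r n)"
  shows "digit_weight r (fibre_point \<pi> b) i = digit_weight r (fibre_point \<pi> (\<lambda>_. False)) i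
    + (if b i then 2 * delta r \<pi> i * (int i - 1 - int (l_stat \<pi> i)) else 0)"
proof -
  let ?h = "half_res r (fst \<pi> i)"
  have less: "?h < r div 2" using half_res_less r_ge_2 by blast
  have hr: "half_res r (fst (fibre_point \<pi> b) i) = ?h" for b
    using half_res_double[OF r less] by (simp add: fibre_point_def)
  have del: "delta r \<pi> i = (if ?h = 0 then 1 else 0)"
    using half_res_eq_0_iff[OF color_less[OF assms]] by (simp add: delta_def)
  have z: "fst (fibre_point \<pi> b) i = 0 \<longleftrightarrow> ?h = 0 \<and> \<not> b i" for b
  proof (cases "b i")
    case True
    then have "odd (fst (fibre_point \<pi> b) i)" by (simp add: odd_fibre_point)
    then show ?thesis using True by (metis even_zero)
  next
    case False
    have "(2 * ?h) mod r = 2 * ?h" using less by simp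
    then show ?thesis using False by (simp add: fibre_point_def)
  qed
  show ?thesis unfolding digit_weight_def z hr del by (simp add: algebra_simps)
qed

lemma fibral_len_fibre_point:
  assumes "\<pi> \<in> carrier (G r n)" "\<And>i. b i \<Longrightarrow> i \<in> {1..n}" "fibre_point \<pi> b \<in> A r n"
  shows "fibral_len r n (fibre_point \<pi> b) =
    (\<Sum>i | i \<in> {2..n} \<and> b i. 2 * delta r \<pi> i * (int i - 1 - int (l_stat \<pi> i)))"
proof -
  let ?e = "\<lambda>i. 2 * delta r \<pi> i * (int i - 1 - int (l_stat \<pi> i))"
  \<comment> \<open>The lift with all colours even may lie outside \<open>A r n\<close> and serves
    only as a reference for weights; the length is taken at the section, given by
    \<open>?b0\<close>.\<close>
  let ?b0 = "\<lambda>i. i = 1 \<and> odd (inv_number n (snd \<pi>))"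
  have w: "weight r n (fibre_point \<pi> b) = weight r n (fibre_point \<pi> (\<lambda>_. False))
      + (\<Sum>i | i \<in> {2..n} \<and> b i. ?e i)" for b
  proof -
    \<comment> \<open>The term of the digit 1 vanishes, since \<open>l_stat\<close> is 0
      there.\<close>
    have "(\<Sum>i=1..n. if b i then ?e i else 0) = (\<Sum>i=2..n. if b i then ?e i else 0)"
      by (simp add: sum_head)
    also have "\<dots> = (\<Sum>i | i \<in> {2..n} \<and> b i. ?e i)"
      using sum.inter_filter[of "{2..n}" ?e b] by simp
    finally show ?thesis
      unfolding weight_def digit_weight_fibre_point[OF assms(1), of b] sum.distrib by simp
  qed
  have b0: "{i. ?b0 i} = (if odd (inv_number n (snd \<pi>)) then {1} else {})" by auto
  have "even (card {i. ?b0 i} + inv_number n (snd \<pi>))" unfolding b0 by simp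
  moreover have "i \<in> {1..n}" if "?b0 i" for i using that n by simp
  ultimately have "fibre_point \<pi> ?b0 \<in> A r n"
    using fibre_point_in_A[OF assms(1), of ?b0] by blast
  then have "int (len_A r n (fibre_point \<pi> ?b0)) = weight r n (fibre_point \<pi> ?b0)"
    using len_A_eq_weight A_iff by blast
  moreover have "{i. i \<in> {2..n} \<and> ?b0 i} = {}" by auto
  then have "weight r n (fibre_point \<pi> ?b0) = weight r n (fibre_point \<pi> (\<lambda>_. False))"
    using w[of ?b0] by simp
  moreover have "int (len_A r n (fibre_point \<pi> b)) = weight r n (fibre_point \<pi> b)"
    using len_A_eq_weight assms(3) A_iff by blast
  ultimately show ?thesis
    using w[of b] unfolding fibral_len_def cover_fibre_point cover_section_cover by simp
qed

text \<open>The fibre is indexed by the set \<open>S\<close> of digits from 2 on with odd colour;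
  membership in \<open>A r n\<close> then forces the colour of 1.\<close>

lemma fiber_gf_eq_sum_Pow:
  assumes "\<pi> \<in> A r n"
  shows "fiber_gf r n \<pi> =
    (\<Sum>S\<in>Pow {2..n}. fls_X_intpow (\<Sum>i\<in>S. 2 * delta r \<pi> i * (int i - 1 - int (l_stat \<pi> i))))"
proof -
  let ?m = "inv_number n (snd \<pi>)"
  \<comment> \<open>The digit 1 becomes odd exactly when \<open>card S + ?m\<close> is odd, giving
    the even total that \<open>fibre_point_in_A\<close> demands.\<close>
  let ?b = "\<lambda>S i. i \<in> S \<or> i = 1 \<and> odd (card S + ?m)"
  have \<pi>: "\<pi> \<in> carrier (G r n)" using assms A_iff by blast
  have in_A: "fibre_point \<pi> (?b S) \<in> A r n" if "S \<in> Pow {2..n}" for S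
  proof -
    have fin: "finite S" using that finite_subset by auto
    have notin: "1 \<notin> S" using that by auto
    have "{i. ?b S i} = (if odd (card S + ?m) then insert 1 S else S)" by auto
    then have "even (card {i. ?b S i} + ?m)" using fin notin by auto
    moreover have "i \<in> {1..n}" if "?b S i" for i using that \<open>S \<in> Pow {2..n}\<close> n by auto
    ultimately show ?thesis using fibre_point_in_A[OF \<pi>, of "?b S"] by blast
  qed
  have inv1: "fibre_point \<pi> (?b {i \<in> {2..n}. odd (fst \<sigma> i)}) = \<sigma>"
    if \<sigma>: "\<sigma> \<in> A r n" "cover r \<sigma> = cover r \<pi>" for \<sigma>
  proof -
    have \<sigma>c: "\<sigma> \<in> carrier (G r n)" using \<sigma>(1) A_iff by blast
    define b where "b = (\<lambda>i. odd (fst \<sigma> i))"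
    let ?S = "{i \<in> {2..n}. b i}"
    have b: "i \<in> {1..n}" if "b i" for i using that \<sigma>c by (auto simp: b_def carrier_iff intro: ccontr)
    have pt: "fibre_point \<pi> b = \<sigma>" unfolding b_def by (rule fibre_point_odd_colors[OF \<sigma>c \<sigma>(2)])
    then have even: "even (card {i. b i} + ?m)" using fibre_point_in_A[OF \<pi>, of b] b \<sigma>(1) by simp
    have set: "{i. b i} = (if b 1 then insert 1 ?S else ?S)"
    proof -
      have "i = 1 \<or> i \<in> {2..n}" if "b i" for i using b[OF that] by auto
      then show ?thesis by (auto simp del: atLeastAtMost_iff)
    qed
    have "card {i. b i} = card ?S + (if b 1 then 1 else 0)" unfolding set by simp
    \<comment> \<open>Evenness leaves no freedom at the digit 1, so \<open>?S\<close> alone recovers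
      \<open>b\<close>.\<close>
    with even have "b 1 \<longleftrightarrow> odd (card ?S + ?m)" by (cases "b 1") auto
    then have "?b ?S i \<longleftrightarrow> b i" for i using b[of i] by (cases "i = 1") auto
    then have "?b ?S = b" by blast
    then show ?thesis using pt by (simp add: b_def)
  qed
  have inv2: "{i \<in> {2..n}. odd (fst (fibre_point \<pi> (?b S)) i)} = S" if "S \<in> Pow {2..n}" for S
    using that by (auto simp: odd_fibre_point)
  have len: "fibral_len r n (fibre_point \<pi> (?b S)) = (\<Sum>i\<in>S. 2 * delta r \<pi> i * (int i - 1 - int (l_stat \<pi> i)))"
    if "S \<in> Pow {2..n}" for S
  proof -
    have "{i. i \<in> {2..n} \<and> ?b S i} = S" using that by auto
    moreover have "i \<in> {1..n}" if "?b S i" for i using that \<open>S \<in> Pow {2..n}\<close> n by auto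
    ultimately show ?thesis using fibral_len_fibre_point[OF \<pi> _ in_A[OF that]] by simp
  qed
  show ?thesis
    unfolding fiber_gf_def
  proof (rule sum.reindex_bij_witness[where i = "\<lambda>S. fibre_point \<pi> (?b S)"
        and j = "\<lambda>\<sigma>. {i \<in> {2..n}. odd (fst \<sigma> i)}"])
    fix \<sigma> assume "\<sigma> \<in> {\<sigma> \<in> A r n. cover r \<sigma> = cover r \<pi>}"
    then show "fibre_point \<pi> (?b {i \<in> {2..n}. odd (fst \<sigma> i)}) = \<sigma>" using inv1 by blast
    then show "fls_X_intpow (\<Sum>i\<in>{i \<in> {2..n}. odd (fst \<sigma> i)}. 2 * delta r \<pi> i * (int i - 1 - int (l_stat \<pi> i)))
      = fls_X_intpow (fibral_len r n \<sigma>)"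
      using len[of "{i \<in> {2..n}. odd (fst \<sigma> i)}"] by (simp add: subset_iff)
  qed (use in_A inv2 cover_fibre_point in auto)
qed

end

theorem theorem6p15:
  fixes r n :: nat and \<pi> :: cperm
  assumes "r > 0" and "n > 0" and "r mod 4 = 2" and "\<pi> \<in> A r n"
  shows "fiber_gf r n \<pi> =
    (\<Prod>i=2..n. 1 + fls_X_intpow (2 * delta r \<pi> i * (int i - 1 - int (l_stat \<pi> i))))"
proof -
  interpret coloured_cover r n using assms by unfold_locales
  let ?e = "\<lambda>i. fls_X_intpow (2 * delta r \<pi> i * (int i - 1 - int (l_stat \<pi> i))) :: int fls"
  \<comment> \<open>Expanding the product takes \<open>?e i\<close> for \<open>i\<close> in
    \<open>S\<close> and 1 elsewhere, matching the sum over sets of odd-coloured digits.\<close>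
  have "(\<Prod>i=2..n. ?e i + 1) = (\<Sum>S\<in>Pow {2..n}. (\<Prod>i\<in>S. ?e i) * (\<Prod>i\<in>{2..n} - S. 1))"
    by (rule prod_add) simp
  then show ?thesis
    unfolding fiber_gf_eq_sum_Pow[OF assms(4)] fls_X_intpow_sum by (simp add: add.commute)
qed

end
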